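(* Let $N\ge 2$ be an integer, let $\mathcal{T}_N=\{\tau_1,\dots,\tau_N\}$ be the set of the $N$ roots of the Lobatto polynomial $\mathcal{L}_N$, and let $\tau_{N+1}\in[-1,1]$ with $\tau_{N+1}\notin\mathcal{T}_N$. For $i\in\{1,\dots,N+1\}$ let $$l_i(\tau)=\prod_{j\in\{1,\dots,N+1\}\setminus\{i\}}\frac{\tau-\tau_j}{\tau_i-\tau_j},$$ and let $\bm{D}\in\mathbb{R}^{N\times(N+1)}$ be the matrix with entries $\bm{D}_{ki}=\dot l_i(\tau_k)$, $k\in\{1,\dots,N\}$, $i\in\{1,\dots,N+1\}$. Then $\bm{D}$ is an inversion-ready differentiation matrix over the set of abscissas $\mathcal{T}_N\cup\{\tau_{N+1}\}$ (with rows corresponding to the abscissas in $\mathcal{T}_N$), with order of accuracy $N$.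
   Context: Polynomials: $\mathcal{P}_n$ is the Legendre polynomial of degree $n$, and for $N\ge2$ the Lobatto polynomial of degree $N$ is $\mathcal{L}_N(\tau)=(\tau^2-1)\dot{\mathcal{P}}_{N-1}(\tau)$, where a dot denotes the derivative with respect to $\tau$. It has exactly $N$ distinct roots, all in $[-1,1]$, including $\pm1$. Differentiation matrix: let $\mathcal{A}=\{a_1,\dots,a_M\}\subset\mathbb{R}$ be a set of $M$ distinct abscissas and $\mathcal{B}=\{b_1,\dots,b_n\}\subseteq\mathcal{A}$ a set of $n$ distinct abscissas. A matrix $\bm{D}\in\mathbb{R}^{n\times M}$ is a (first derivative) differentiation matrix over $\mathcal{A}$ (with rows corresponding to $\mathcal{B}$) if $\bm{D}\bm{V}=\bm{V'}$ for some integer $R$ with $1\le R\le M-1$, where $\bm{V}\in\mathbb{R}^{M\times(R+1)}$ is the Vandermonde matrix whose $i$-th row is $(1,a_i,a_i^2,\dots,a_i^R)$ and $\bm{V'}\in\mathbb{R}^{n\times(R+1)}$ is the matrix whose $j$-th row is $(0,1,2b_j,\dots,R\,b_j^{R-1})$. If $\bm{D}\bm{V}=\bm{V'}$ holds for the integer $R$ but does not hold for $R+1$, then $R$ is called the order of accuracy. Inversion-ready: a differentiation matrix $\bm{D}\in\mathbb{R}^{N\times(N+1)}$ over $N+1$ abscissas (for some order of accuracy) is inversion-ready if $\operatorname{rank}(\bm{D})=N$. *)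

theory Defs
  imports "HOL-Analysis.Derivative" "Jordan_Normal_Form.DL_Rank"
begin

(* Rodrigues' formula *)
definition legendre_poly :: "nat \<Rightarrow> real poly" where
  "legendre_poly n = Polynomial.smult (1 / (2 ^ n * fact n)) ((pderiv ^^ n) ([:-1, 0, 1:] ^ n))"

definition lobatto_poly :: "nat \<Rightarrow> real poly" where
  "lobatto_poly N = [:-1, 0, 1:] * pderiv (legendre_poly (N - 1))"

(* A set of abscissas is given by a list without repetitions, which fixes the order of the
   rows and columns of the matrices. *)

definition vandermonde_mat :: "real list \<Rightarrow> nat \<Rightarrow> real mat" where
  "vandermonde_mat xs R = Matrix.mat (length xs) (R + 1) (\<lambda>(i, j). (xs ! i) ^ j)"

(* For j = 0 the entry is 0, whatever the value of the truncated exponent. *)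
definition vandermonde_deriv_mat :: "real list \<Rightarrow> nat \<Rightarrow> real mat" where
  "vandermonde_deriv_mat ys R =
     Matrix.mat (length ys) (R + 1) (\<lambda>(i, j). of_nat j * (ys ! i) ^ (j - 1))"

definition exact_to_degree :: "real list \<Rightarrow> real list \<Rightarrow> real mat \<Rightarrow> nat \<Rightarrow> bool" where
  "exact_to_degree xs ys D R \<longleftrightarrow> D * vandermonde_mat xs R = vandermonde_deriv_mat ys R"

definition differentiation_matrix :: "real list \<Rightarrow> real list \<Rightarrow> real mat \<Rightarrow> bool" where
  "differentiation_matrix xs ys D \<longleftrightarrow>
     distinct xs \<and> distinct ys \<and> set ys \<subseteq> set xs \<and>
     D \<in> carrier_mat (length ys) (length xs) \<and>
     (\<exists>R. 1 \<le> R \<and> R \<le> length xs - 1 \<and> exact_to_degree xs ys D R)"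

(* The equation for R + 1 is required to fail even when R + 1 > length xs - 1. *)
definition order_of_accuracy :: "real list \<Rightarrow> real list \<Rightarrow> real mat \<Rightarrow> nat \<Rightarrow> bool" where
  "order_of_accuracy xs ys D R \<longleftrightarrow>
     differentiation_matrix xs ys D \<and> 1 \<le> R \<and> R \<le> length xs - 1 \<and>
     exact_to_degree xs ys D R \<and> \<not> exact_to_degree xs ys D (R + 1)"

definition inversion_ready :: "real list \<Rightarrow> real list \<Rightarrow> real mat \<Rightarrow> bool" where
  "inversion_ready xs ys D \<longleftrightarrow>
     differentiation_matrix xs ys D \<and> length xs = length ys + 1 \<and>
     vec_space.rank (dim_row D) D = length ys"

definition lagrange_fun :: "nat \<Rightarrow> (nat \<Rightarrow> real) \<Rightarrow> nat \<Rightarrow> real \<Rightarrow> real" where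
  "lagrange_fun N \<tau> i t = (\<Prod>j\<in>{1..N+1} - {i}. (t - \<tau> j) / (\<tau> i - \<tau> j))"

(* The matrix indices start at 0, those of the abscissas at 1. *)
definition lagrange_diff_mat :: "nat \<Rightarrow> (nat \<Rightarrow> real) \<Rightarrow> real mat" where
  "lagrange_diff_mat N \<tau> =
     Matrix.mat N (N + 1) (\<lambda>(k, i). deriv (lagrange_fun N \<tau> (i + 1)) (\<tau> (k + 1)))"

end

theory Submission
  imports Defs
begin

text \<open>
  The proof rests on the distinctness of the \<open>N + 1\<close> abscissas: \<open>\<tau>\<close> enumerates the \<open>N\<close> Lobatto
  roots injectively and \<open>\<tau> (N + 1)\<close> is not one of them.

  The matrix equation \<open>D V = V'\<close> says that \<open>D\<close> maps the values of every polynomial of degree at most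
  \<open>R\<close> at the abscissas to the values of its derivative at the row nodes
  (\<open>exact_to_degree_iff_poly\<close>), because monomials span. Three consequences give the theorem.

  The Lagrange matrix is exact to degree \<open>N\<close>, since a polynomial of degree at most \<open>N\<close> equals its
  interpolant at \<open>N + 1\<close> nodes, and one may differentiate the interpolant
  (\<open>lagrange_diff_mat_exact\<close>).

  It is not exact to degree \<open>N + 1\<close>: the monic polynomial with simple roots exactly at the \<open>N + 1\<close>
  abscissas has zero values there, but its derivative vanishes at none of them
  (\<open>not_exact_to_degree_length\<close>).

  Its rank is \<open>N\<close>: antidifferentiating the cardinal polynomials of the \<open>N\<close> row nodes gives
  polynomials of degree at most \<open>N\<close> whose derivatives take the values of the unit vectors at the
  row nodes; sampled at the abscissas they are the columns of a right inverse of \<open>D\<close>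
  (\<open>rank_exact_to_degree\<close>).
\<close>

definition lagrange_basis :: "'i set \<Rightarrow> ('i \<Rightarrow> real) \<Rightarrow> 'i \<Rightarrow> real poly" where
  "lagrange_basis I x i =
     Polynomial.smult (1 / (\<Prod>j\<in>I - {i}. x i - x j)) (\<Prod>j\<in>I - {i}. [:- x j, 1:])"

lemma poly_lagrange_basis:
  "poly (lagrange_basis I x i) t = (\<Prod>j\<in>I - {i}. (t - x j) / (x i - x j))"
  by (simp add: lagrange_basis_def poly_prod prod_dividef)

lemma poly_lagrange_basis_node:
  assumes "finite I" "inj_on x I" "i \<in> I" "k \<in> I"
  shows "poly (lagrange_basis I x i) (x k) = (if k = i then 1 else 0)"
proof (cases "k = i")
  case True
  have "(x i - x j) / (x i - x j) = 1" if "j \<in> I - {i}" for j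
    using assms that by (auto simp: inj_on_def)
  then show ?thesis using True by (simp add: poly_lagrange_basis)
next
  case False
  then show ?thesis using assms by (auto simp: poly_lagrange_basis)
qed

lemma degree_lagrange_basis:
  assumes "finite I" "i \<in> I"
  shows "degree (lagrange_basis I x i) < card I"
proof -
  have "degree (\<Prod>j\<in>I - {i}. [:- x j, 1:]) \<le> card I - 1"
    using assms by (subst degree_prod_eq_sum_degree) auto
  moreover have "card I > 0" using assms by (auto simp: card_gt_0_iff)
  ultimately show ?thesis
    using degree_smult_le[of "1 / (\<Prod>j\<in>I - {i}. x i - x j)" "\<Prod>j\<in>I - {i}. [:- x j, 1:]"]
    unfolding lagrange_basis_def by linarith
qed

text \<open>Both sides have degree below \<open>card I\<close> and agree at \<open>card I\<close> points.\<close>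

lemma lagrange_interpolation:
  assumes "finite I" "inj_on x I" "degree p < card I"
  shows "p = (\<Sum>i\<in>I. Polynomial.smult (poly p (x i)) (lagrange_basis I x i))" (is "p = ?q")
proof (rule poly_eqI_degree[where A = "x ` I"])
  show "poly p t = poly ?q t" if "t \<in> x ` I" for t
  proof -
    from that obtain k where k: "k \<in> I" "t = x k" by auto
    have "poly ?q t = (\<Sum>i\<in>I. if k = i then poly p (x i) else 0)"
      unfolding poly_sum
      using k assms by (intro sum.cong) (auto simp: poly_lagrange_basis_node)
    then show ?thesis using k assms by simp
  qed
  have card: "card (x ` I) = card I" using assms by (simp add: card_image)
  show "card (x ` I) > degree p" using assms card by simp
  have "degree ?q < card I"
    using degree_lagrange_basis[OF assms(1), of _ x] assms(3)
    by (intro degree_sum_less) (auto intro: le_less_trans[OF degree_smult_le])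
  then show "card (x ` I) > degree ?q" using card by simp
qed

lemma pderiv_sum: "pderiv (sum f A) = (\<Sum>i\<in>A. pderiv (f i))"
  using higher_pderiv_sum[of 1 f A] by simp

lemma antiderivative_poly_exists:
  fixes p :: "'a :: field_char_0 poly"
  shows "\<exists>q. pderiv q = p \<and> degree q \<le> degree p + 1"
proof (intro exI conjI)
  let ?q = "\<Sum>j\<le>degree p. monom (coeff p j / of_nat (j + 1)) (j + 1)"
  have "pderiv ?q = (\<Sum>j\<le>degree p. monom (coeff p j) j)"
    by (simp add: pderiv_sum pderiv_monom del: of_nat_Suc)
  then show "pderiv ?q = p" by (simp add: poly_as_sum_of_monoms)
  show "degree ?q \<le> degree p + 1"
    by (intro degree_sum_le) (auto intro: order.trans[OF degree_monom_le])
qed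

text \<open>Both sides of the condition are linear in the polynomial, so that the columns of
  \<open>D V = V'\<close>, which test the monomials, suffice.\<close>

lemma exact_to_degree_iff_poly:
  assumes D: "D \<in> carrier_mat (length ys) (length xs)"
  shows "exact_to_degree xs ys D R \<longleftrightarrow>
    (\<forall>p. degree p \<le> R \<longrightarrow> (\<forall>k<length ys.
      (\<Sum>i<length xs. D $$ (k, i) * poly p (xs ! i)) = poly (pderiv p) (ys ! k)))"
    (is "_ \<longleftrightarrow> ?poly")
proof -
  have monomials: "exact_to_degree xs ys D R \<longleftrightarrow>
    (\<forall>k<length ys. \<forall>j\<le>R. (\<Sum>i<length xs. D $$ (k, i) * (xs ! i) ^ j)
      = of_nat j * (ys ! k) ^ (j - 1))"
    using D unfolding exact_to_degree_def vandermonde_mat_def vandermonde_deriv_mat_def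
    by (auto simp: mat_eq_iff scalar_prod_def less_Suc_eq_le atLeast0LessThan)
  show ?thesis
  proof
    assume ex: "exact_to_degree xs ys D R"
    show ?poly
    proof (intro allI impI)
      fix p :: "real poly" and k assume p: "degree p \<le> R" and k: "k < length ys"
      have eval: "poly p x = (\<Sum>j\<le>R. coeff p j * x ^ j)" for x
        using arg_cong[OF poly_as_sum_of_monoms'[OF p], of "\<lambda>p. poly p x"]
        by (simp add: poly_sum poly_monom)
      have "(\<Sum>i<length xs. D $$ (k, i) * poly p (xs ! i))
          = (\<Sum>i<length xs. \<Sum>j\<le>R. coeff p j * (D $$ (k, i) * (xs ! i) ^ j))"
        by (simp add: eval sum_distrib_left mult_ac)
      also have "\<dots> = (\<Sum>j\<le>R. coeff p j * (\<Sum>i<length xs. D $$ (k, i) * (xs ! i) ^ j))"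
        by (subst sum.swap) (simp add: sum_distrib_left)
      also have "\<dots> = (\<Sum>j\<le>R. coeff p j * (of_nat j * (ys ! k) ^ (j - 1)))"
        using ex k by (simp add: monomials)
      also have "\<dots> = poly (pderiv (\<Sum>j\<le>R. monom (coeff p j) j)) (ys ! k)"
        by (simp add: pderiv_sum poly_sum pderiv_monom poly_monom mult_ac)
      finally show "(\<Sum>i<length xs. D $$ (k, i) * poly p (xs ! i)) = poly (pderiv p) (ys ! k)"
        by (simp add: poly_as_sum_of_monoms'[OF p])
    qed
  next
    assume poly: ?poly
    show "exact_to_degree xs ys D R"
      unfolding monomials
    proof (intro allI impI)
      fix k j assume "k < length ys" "j \<le> R"
      then show "(\<Sum>i<length xs. D $$ (k, i) * (xs ! i) ^ j) = of_nat j * (ys ! k) ^ (j - 1)"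
        using poly[rule_format, of "monom 1 j" k] degree_monom_le[of "1::real" j]
        by (simp add: poly_monom pderiv_monom)
    qed
  qed
qed

text \<open>The polynomial with simple roots at the abscissas is a counterexample to exactness: its
  values at the abscissas are zero, whereas its derivative is nonzero at each simple root.\<close>

lemma not_exact_to_degree_length:
  assumes D: "D \<in> carrier_mat (length ys) (length xs)"
    and "distinct xs" "set ys \<subseteq> set xs" "ys \<noteq> []"
  shows "\<not> exact_to_degree xs ys D (length xs)"
proof
  assume ex: "exact_to_degree xs ys D (length xs)"
  let ?p = "\<Prod>x\<in>set xs. [:- x, 1:]" and ?y = "ys ! 0"
  let ?q = "\<Prod>x\<in>set xs - {?y}. [:- x, 1:]"
  have y: "?y \<in> set xs" using assms by auto
  have "degree ?p \<le> length xs"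
    using \<open>distinct xs\<close> by (subst degree_prod_eq_sum_degree) (auto simp: distinct_card)
  then have "poly (pderiv ?p) ?y = (\<Sum>i<length xs. D $$ (0, i) * poly ?p (xs ! i))"
    using ex \<open>ys \<noteq> []\<close> by (simp add: exact_to_degree_iff_poly[OF D])
  also have "\<dots> = 0"
    by (intro sum.neutral) (auto simp: poly_prod)
  finally have "poly (pderiv ?p) ?y = 0" .
  moreover have "?p = [:- ?y, 1:] * ?q" using y by (simp add: prod.remove)
  then have "poly (pderiv ?p) ?y = poly ?q ?y"
    by (simp only: pderiv_mult) (simp add: pderiv_pCons)
  moreover have "poly ?q ?y \<noteq> 0" by (simp add: poly_prod)
  ultimately show False by simp
qed

text \<open>Row \<open>k\<close> of the matrix applied to the values of a polynomial is the derivative of its Lagrange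
  interpolant at the \<open>k\<close>-th node, and a polynomial of degree at most \<open>N\<close> is its own interpolant
  at \<open>N + 1\<close> nodes.\<close>

lemma lagrange_diff_mat_exact:
  assumes inj: "inj_on \<tau> {1..N+1}"
  shows "exact_to_degree (map \<tau> [1..<N+2]) (map \<tau> [1..<N+1]) (lagrange_diff_mat N \<tau>) N"
proof -
  let ?I = "{1..N+1}" and ?l = "lagrange_basis {1..N+1} \<tau>"
  have l: "lagrange_fun N \<tau> i = poly (?l i)" for i
    by (rule ext) (simp add: lagrange_fun_def poly_lagrange_basis)
  \<comment> \<open>Matrix indices start at 0, node indices at 1.\<close>
  have D: "lagrange_diff_mat N \<tau> $$ (k, i) = poly (pderiv (?l (i + 1))) (\<tau> (k + 1))"
    if "k < N" "i < N + 1" for k i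
    using that by (simp add: lagrange_diff_mat_def l DERIV_imp_deriv[OF poly_DERIV])
  have "(\<Sum>i<N+1. lagrange_diff_mat N \<tau> $$ (k, i) * poly p (\<tau> (i + 1)))
      = poly (pderiv p) (\<tau> (k + 1))" if "degree p \<le> N" "k < N" for p k
  proof -
    have "p = (\<Sum>i\<in>?I. Polynomial.smult (poly p (\<tau> i)) (?l i))"
      by (rule lagrange_interpolation) (use inj that in auto)
    then have "poly (pderiv p) (\<tau> (k + 1))
        = poly (pderiv (\<Sum>i\<in>?I. Polynomial.smult (poly p (\<tau> i)) (?l i))) (\<tau> (k + 1))"
      by simp
    also have "\<dots> = (\<Sum>i\<in>?I. poly p (\<tau> i) * poly (pderiv (?l i)) (\<tau> (k + 1)))"
      by (simp only: pderiv_sum pderiv_smult poly_sum poly_smult)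
    also have "\<dots> = (\<Sum>i<N+1. poly p (\<tau> (i + 1)) * poly (pderiv (?l (i + 1))) (\<tau> (k + 1)))"
      by (rule sum.reindex_bij_witness[of _ "\<lambda>i. i + 1" "\<lambda>i. i - 1"]) auto
    also have "\<dots> = (\<Sum>i<N+1. lagrange_diff_mat N \<tau> $$ (k, i) * poly p (\<tau> (i + 1)))"
      using that by (intro sum.cong) (auto simp: D)
    finally show ?thesis by simp
  qed
  then show ?thesis
    by (subst exact_to_degree_iff_poly) (auto simp: lagrange_diff_mat_def simp del: upt_Suc)
qed

text \<open>Every vector \<open>v = D (E v)\<close> lies in the column space, which is therefore the whole space.\<close>

lemma (in vec_space) rank_right_inverse:
  assumes D: "D \<in> carrier_mat n m" and E: "E \<in> carrier_mat m n" and DE: "D * E = 1\<^sub>m n"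
  shows "rank D = n"
proof -
  have "v \<in> col_space D" if v: "v \<in> carrier_vec n" for v
  proof -
    have "D *\<^sub>v (E *\<^sub>v v) = v"
      using assoc_mult_mat_vec[OF D E v] DE v by simp
    moreover have "E *\<^sub>v v \<in> carrier_vec m" using E v by simp
    ultimately show ?thesis using D v by (auto simp: col_space_eq[OF D])
  qed
  then have "span (set (cols D)) = carrier_vec n"
    using span_closed[of "set (cols D)"] cols_dim[of D] D by (auto simp: col_space_def)
  moreover have "vs (carrier_vec n) = V" by (simp add: module_vec_def)
  ultimately show ?thesis using dim_is_n by (simp only: rank_def)
qed

text \<open>Exactness turns antiderivatives of the cardinal polynomials of \<open>ys\<close> into a right inverse:
  their derivatives take the values of the unit vectors at \<open>ys\<close>, and their degrees do not exceed
  \<open>length ys\<close>.\<close>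

lemma rank_exact_to_degree:
  assumes D: "D \<in> carrier_mat (length ys) (length xs)"
    and "distinct ys" and ex: "exact_to_degree xs ys D R" and "length ys \<le> R"
  shows "vec_space.rank (length ys) D = length ys"
proof -
  let ?n = "length ys"
  let ?l = "lagrange_basis {..<?n} ((!) ys)"
  have "\<forall>k. \<exists>q. pderiv q = ?l k \<and> degree q \<le> degree (?l k) + 1"
    using antiderivative_poly_exists by blast
  then obtain q where q: "\<And>k. pderiv (q k) = ?l k" "\<And>k. degree (q k) \<le> degree (?l k) + 1"
    by metis
  define E where "E = Matrix.mat (length xs) ?n (\<lambda>(i, k). poly (q k) (xs ! i))"
  have deg: "degree (q k) \<le> R" if "k < ?n" for k
    using degree_lagrange_basis[of "{..<?n}" k "(!) ys"] q(2)[of k] that \<open>?n \<le> R\<close> by simp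
  have inj: "inj_on ((!) ys) {..<?n}" using \<open>distinct ys\<close> by (simp add: inj_on_nth)
  have "D * E = 1\<^sub>m ?n"
  proof (rule eq_matI)
    fix j k assume "j < dim_row (1\<^sub>m ?n :: real mat)" "k < dim_col (1\<^sub>m ?n :: real mat)"
    then have jk: "j < ?n" "k < ?n" by auto
    have "(D * E) $$ (j, k) = (\<Sum>i<length xs. D $$ (j, i) * poly (q k) (xs ! i))"
      using jk D by (simp add: E_def scalar_prod_def atLeast0LessThan)
    also have "\<dots> = poly (pderiv (q k)) (ys ! j)"
      using ex jk deg by (simp add: exact_to_degree_iff_poly[OF D])
    also have "\<dots> = 1\<^sub>m ?n $$ (j, k)"
      using jk inj by (simp add: q(1) poly_lagrange_basis_node)
    finally show "(D * E) $$ (j, k) = 1\<^sub>m ?n $$ (j, k)" .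
  qed (use D in \<open>auto simp: E_def\<close>)
  then show ?thesis
    by (rule vec_space.rank_right_inverse[OF D, rotated]) (simp add: E_def)
qed

theorem theorem1:
  fixes N :: nat and \<tau> :: "nat \<Rightarrow> real"
  assumes "N \<ge> 2"
    and "bij_betw \<tau> {1..N} {t. poly (lobatto_poly N) t = 0}"
    and "\<tau> (N + 1) \<in> {-1..1}"
    and "\<tau> (N + 1) \<notin> \<tau> ` {1..N}"
  shows "inversion_ready (map \<tau> [1..<N+2]) (map \<tau> [1..<N+1]) (lagrange_diff_mat N \<tau>)
    \<and> order_of_accuracy (map \<tau> [1..<N+2]) (map \<tau> [1..<N+1]) (lagrange_diff_mat N \<tau>) N"
proof -
  let ?xs = "map \<tau> [1..<N+2]" and ?ys = "map \<tau> [1..<N+1]" and ?D = "lagrange_diff_mat N \<tau>"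
  have "{1..N+1} = insert (N + 1) {1..N}" by auto
  then have inj: "inj_on \<tau> {1..N+1}"
    using assms(2,4) by (auto simp: bij_betw_def)
  have sets: "set [1..<N+2] = {1..N+1}" "set [1..<N+1] = {1..N}" by auto
  have xs: "distinct ?xs" "length ?xs = N + 1"
    using inj unfolding distinct_map sets by simp_all
  have ys: "distinct ?ys" "length ?ys = N" "set ?ys \<subseteq> set ?xs"
    using inj_on_subset[OF inj, of "{1..N}"] unfolding distinct_map set_map sets by auto
  have D: "?D \<in> carrier_mat (length ?ys) (length ?xs)"
    unfolding xs ys by (simp add: lagrange_diff_mat_def)
  have exact: "exact_to_degree ?xs ?ys ?D N"
    using inj by (rule lagrange_diff_mat_exact)
  have diff: "differentiation_matrix ?xs ?ys ?D"
    unfolding differentiation_matrix_def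
    using xs ys D exact \<open>N \<ge> 2\<close> by (auto simp del: upt_Suc intro!: exI[of _ N])
  have "vec_space.rank (length ?ys) ?D = length ?ys"
    using D ys exact by (intro rank_exact_to_degree) auto
  moreover have "\<not> exact_to_degree ?xs ?ys ?D (length ?xs)"
    using D xs(1) ys(3) by (rule not_exact_to_degree_length) (use \<open>N \<ge> 2\<close> in auto)
  ultimately show ?thesis
    using diff exact xs ys D \<open>N \<ge> 2\<close>
    unfolding inversion_ready_def order_of_accuracy_def by (simp del: upt_Suc)
qed

end
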